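(* Let $n,M\ge1$, let $\mathcal{L}:\mathbb{R}^n\to\mathbb{R}_+$ be convex and positively homogeneous, let $\dot x\in\mathbb{R}^n$ and $v_1,\dots,v_M\in\mathbb{R}^n$. If there exist $j^\star\in\{1,\dots,M\}$ and $w\in\mathbb{R}^n$ with $\mathcal{L}^\ast(w)\le 1$ such that $w\in\partial\mathcal{L}(\dot x-v_{j^\star})$ and $$\langle w,v_{j^\star}\rangle>\max_{j\ne j^\star}\langle w,v_j\rangle,$$ then the unique minimizer of $$\min_{\lambda\in\Delta}\ \mathcal{L}\Big(\dot x-\sum_{j=1}^M\lambda_jv_j\Big)$$ is $\lambda^\star=e_{j^\star}$.
   Context: $\Delta=\{\lambda\in\mathbb{R}^M:\lambda\ge0,\ \mathbf{1}^T\lambda=1\}$ is the probability simplex and $e_j$ is the $j$-th canonical basis vector of $\mathbb{R}^M$. $\mathbb{R}_+=[0,\infty)$. $\mathcal{L}^\ast$ is the dual of $\mathcal{L}$ (the dual norm if $\mathcal{L}$ is a norm), $\mathcal{L}^\ast(w)=\sup\{\langle w,r\rangle:\mathcal{L}(r)\le1\}$, so that $\mathcal{L}(r)=\sup_{\mathcal{L}^\ast(w)\le1}\langle w,r\rangle$. $\partial\mathcal{L}$ denotes the convex subdifferential. In the application $\dot x$ is a measured derivative at a state $x$ and $v_j=X_j(x)$ is the value at $x$ of the vector field of mode $j$. *)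

theory Defs
  imports "HOL-Analysis.Analysis"
begin

text \<open>Homogeneity is required for positive scalars only; for a real-valued function this
  already forces \<open>f 0 = 0\<close>.\<close>

definition positively_homogeneous :: "('a::real_vector \<Rightarrow> real) \<Rightarrow> bool" where
  "positively_homogeneous f \<longleftrightarrow> (\<forall>t>0. \<forall>x. f (t *\<^sub>R x) = t * f x)"

text \<open>The supremum is taken in the extended reals: it is infinite when \<open>\<lambda>r. w \<bullet> r\<close> is unbounded
  above on the sublevel set, which can happen because \<open>L\<close> need not be a norm.\<close>

definition dual_fun :: "('a::real_inner \<Rightarrow> real) \<Rightarrow> 'a \<Rightarrow> ereal" where
  "dual_fun L w = (SUP r\<in>{r. L r \<le> 1}. ereal (w \<bullet> r))"

definition subdifferential :: "('a::real_inner \<Rightarrow> real) \<Rightarrow> 'a \<Rightarrow> 'a set" where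
  "subdifferential f x = {w. \<forall>y. f x + w \<bullet> (y - x) \<le> f y}"

definition prob_simplex :: "(real ^ 'm::finite) set" where
  "prob_simplex = {l. (\<forall>j. 0 \<le> l $ j) \<and> (\<Sum>j\<in>UNIV. l $ j) = 1}"

text \<open>The maximum of the scores \<open>w \<bullet> v j\<close> over the modes other than \<open>j0\<close>, as a supremum of a finite
  set of extended reals; it is \<open>- \<infinity>\<close> when \<open>j0\<close> is the only mode.\<close>

definition max_other_score :: "'a::real_inner \<Rightarrow> ('m::finite \<Rightarrow> 'a) \<Rightarrow> 'm \<Rightarrow> ereal" where
  "max_other_score w v j0 = (SUP j\<in>UNIV - {j0}. ereal (w \<bullet> v j))"

end

theory Submission imports Defs begin

text \<open>Since \<open>w\<close> is a subgradient at the residual of mode \<open>j\<^sup>*\<close>, the objective at \<open>\<lambda>\<close> exceeds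
  its value at \<open>e\<^bsub>j\<^sup>*\<^esub>\<close> by at least
  \<open>\<langle>w, v\<^bsub>j\<^sup>*\<^esub> - \<Sum>\<^sub>j \<lambda>\<^sub>j v\<^sub>j\<rangle> = \<Sum>\<^sub>j \<lambda>\<^sub>j \<langle>w, v\<^bsub>j\<^sup>*\<^esub> - v\<^sub>j\<rangle>\<close>. All terms are nonnegative,
  and the gap hypothesis makes the sum positive as soon as some \<open>\<lambda>\<^sub>j\<close> with \<open>j \<noteq> j\<^sup>*\<close> is positive.\<close>

lemma axis_in_prob_simplex: "axis j 1 \<in> prob_simplex"
  by (simp add: prob_simplex_def axis_def)

lemma sum_axis_scaleR:
  fixes v :: "'m::finite \<Rightarrow> 'a::real_vector"
  shows "(\<Sum>j\<in>UNIV. axis k (1::real) $ j *\<^sub>R v j) = v k"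
proof -
  have "(\<Sum>j\<in>UNIV. axis k (1::real) $ j *\<^sub>R v j) = (\<Sum>j\<in>UNIV. if j = k then v j else 0)"
    by (intro sum.cong) (auto simp: axis_def)
  then show ?thesis by simp
qed

text \<open>Only finitely many modes are involved, so a nonempty supremum is attained; over an
  infinite family, strict bounds on the scores would give only a weak bound on their
  supremum.\<close>

lemma max_other_score_less_iff:
  "max_other_score w v k < ereal (w \<bullet> v k) \<longleftrightarrow> (\<forall>j. j \<noteq> k \<longrightarrow> w \<bullet> v j < w \<bullet> v k)"
proof (cases "UNIV - {k} = {}")
  case True
  \<comment> \<open>With \<open>k\<close> the only mode, the empty supremum is -\<infinity>, below
    every real score, and the right-hand side is vacuous.\<close>
  then show ?thesis
    unfolding max_other_score_def True using True by (auto simp: bot_ereal_def)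
next
  case False
  then show ?thesis
    unfolding max_other_score_def
    by (subst Max_Sup[symmetric]) auto
qed

lemma prob_simplex_inner_sum_less:
  fixes l :: "real ^ 'm::finite"
  assumes "l \<in> prob_simplex" and "l \<noteq> axis k 1"
    and gap: "\<And>j. j \<noteq> k \<Longrightarrow> w \<bullet> v j < w \<bullet> v k"
  shows "w \<bullet> (\<Sum>j\<in>UNIV. l $ j *\<^sub>R v j) < w \<bullet> v k"
proof -
  have nn: "0 \<le> l $ j" for j
    using assms(1) by (simp add: prob_simplex_def)
  have one: "(\<Sum>j\<in>UNIV. l $ j) = 1"
    using assms(1) by (simp add: prob_simplex_def)
  \<comment> \<open>Otherwise the whole unit mass sits at \<open>k\<close>, which forces
    \<open>l\<close> to be the excluded vertex.\<close>
  have "\<exists>i. i \<noteq> k \<and> l $ i \<noteq> 0"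
  proof (rule ccontr)
    assume "\<not> ?thesis"
    then have z: "l $ i = 0" if "i \<noteq> k" for i using that by blast
    then have "(\<Sum>j\<in>UNIV. l $ j) = (\<Sum>j\<in>{k}. l $ j)"
      by (intro sum.mono_neutral_right) auto
    then have "l = axis k 1" using z one by (auto simp: vec_eq_iff axis_def)
    with assms(2) show False ..
  qed
  then obtain i where i: "i \<noteq> k" "0 < l $ i" using nn by (metis less_eq_real_def)
  have le: "w \<bullet> v j \<le> w \<bullet> v k" for j
    using gap[of j] by (cases "j = k") auto
  have "w \<bullet> (\<Sum>j\<in>UNIV. l $ j *\<^sub>R v j) = (\<Sum>j\<in>UNIV. l $ j * (w \<bullet> v j))"
    by (simp add: inner_sum_right)
  also have "\<dots> < (\<Sum>j\<in>UNIV. l $ j * (w \<bullet> v k))"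
    using gap[OF i(1)] i(2) le nn
    \<comment> \<open>The weak bound holds termwise, and the positive weight at \<open>i\<close>
      makes that one term strict.\<close>
    by (intro sum_strict_mono_ex1) (auto intro!: mult_left_mono exI[of _ i] mult_strict_left_mono)
  also have "\<dots> = w \<bullet> v k"
    by (simp add: one flip: sum_distrib_right)
  finally show ?thesis .
qed

theorem theorem3:
  fixes L :: "real ^ 'n \<Rightarrow> real"
    and xdot :: "real ^ 'n"
    and v :: "'m::finite \<Rightarrow> real ^ 'n"
    and jstar :: 'm
    and w :: "real ^ 'n"
  assumes "\<And>r. 0 \<le> L r"
    and "convex_on UNIV L"
    and "positively_homogeneous L"
    and "dual_fun L w \<le> 1"
    and "w \<in> subdifferential L (xdot - v jstar)"
    and "ereal (w \<bullet> v jstar) > max_other_score w v jstar"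
  shows "{l. is_arg_min (\<lambda>l. L (xdot - (\<Sum>j\<in>UNIV. l $ j *\<^sub>R v j))) (\<lambda>l. l \<in> prob_simplex) l}
    = {axis jstar 1}"
proof -
  let ?F = "\<lambda>l. L (xdot - (\<Sum>j\<in>UNIV. l $ j *\<^sub>R v j))"
  have gap: "w \<bullet> v j < w \<bullet> v jstar" if "j \<noteq> jstar" for j
    using assms(6) that by (simp add: max_other_score_less_iff)
  \<comment> \<open>Strictness against every other simplex point yields minimality and uniqueness at
    once.\<close>
  have less: "?F (axis jstar 1) < ?F l" if "l \<in> prob_simplex" "l \<noteq> axis jstar 1" for l
  proof -
    let ?s = "\<Sum>j\<in>UNIV. l $ j *\<^sub>R v j"
    \<comment> \<open>The subgradient inequality is tested at the residual of \<open>l\<close>;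
      \<open>xdot\<close> cancels in the increment, leaving \<open>v jstar - ?s\<close>.\<close>
    have "L (xdot - v jstar) + w \<bullet> ((xdot - ?s) - (xdot - v jstar)) \<le> L (xdot - ?s)"
      using assms(5) unfolding subdifferential_def by blast
    moreover have "w \<bullet> ?s < w \<bullet> v jstar"
      using that gap by (rule prob_simplex_inner_sum_less)
    ultimately show ?thesis
      by (simp only: sum_axis_scaleR inner_diff_right)
  qed
  have "is_arg_min ?F (\<lambda>l. l \<in> prob_simplex) l \<longleftrightarrow> l = axis jstar 1" for l
  proof
    assume "is_arg_min ?F (\<lambda>l. l \<in> prob_simplex) l"
    then show "l = axis jstar 1"
      using less[of l] axis_in_prob_simplex[of jstar] unfolding is_arg_min_def by blast
  next
    assume l: "l = axis jstar 1"
    have "\<not> ?F y < ?F (axis jstar 1)" if "y \<in> prob_simplex" for y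
      using less[OF that] by (cases "y = axis jstar 1") (simp, metis less_asym)
    then show "is_arg_min ?F (\<lambda>l. l \<in> prob_simplex) l"
      unfolding is_arg_min_def l using axis_in_prob_simplex[of jstar] by blast
  qed
  then show ?thesis by blast
qed

end
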